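(* Let $p$ be an odd prime and let $G$ be a finite $p$-group. Let $i$ be a non-negative integer with $i \leq p-3$. If $G$ is an $\mathcal{M}_i$ group, then $G$ is a potent $p$-group.
   Context: For a finite $p$-group $G$ and $k\ge 0$, $\mho_k(G)=\langle g^{p^k} \mid g\in G\rangle$. The lower central series is $\gamma_1(G)=G$, $\gamma_{j}(G)=[\gamma_{j-1}(G),G]$ for $j>1$. For $p$ odd, a finite $p$-group $G$ is powerful if $[G,G]\leq \mho_1(G)$. For $p$ odd, a finite $p$-group $G$ is potent if $\gamma_{p-1}(G)\leq \mho_1(G)$. A finite $p$-group $G$ is an $\mathcal{M}_i$ group if all subgroups of index $p^i$ in $G$ are powerful. *)

theory Defs
  imports "HOL-Algebra.Algebra" "HOL-Computational_Algebra.Primes"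
begin

(* HOL-Algebra has its own constant prime (relative to a monoid), hence the qualified name for
   prime numbers.  Finiteness of the carrier follows, since card yields 0 on infinite sets. *)
definition finite_p_group :: "nat \<Rightarrow> ('a, 'b) monoid_scheme \<Rightarrow> bool" where
  "finite_p_group p G \<longleftrightarrow>
     Factorial_Ring.prime p \<and> group G \<and> (\<exists>n::nat. order G = p ^ n)"

definition agemo :: "nat \<Rightarrow> nat \<Rightarrow> ('a, 'b) monoid_scheme \<Rightarrow> 'a set" where
  "agemo p k G = generate G {g [^]\<^bsub>G\<^esub> (p ^ k) | g. g \<in> carrier G}"

(* The commutator is written as in derived_set, so that commutator_subgroup G H H = derived G H.
   Using the inverses of a and b instead gives the same subgroup when H and K are subgroups. *)
definition commutator_subgroup ::
    "('a, 'b) monoid_scheme \<Rightarrow> 'a set \<Rightarrow> 'a set \<Rightarrow> 'a set" where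
  "commutator_subgroup G H K =
     generate G {a \<otimes>\<^bsub>G\<^esub> b \<otimes>\<^bsub>G\<^esub> inv\<^bsub>G\<^esub> a \<otimes>\<^bsub>G\<^esub> inv\<^bsub>G\<^esub> b | a b. a \<in> H \<and> b \<in> K}"

lemma commutator_subgroup_self: "commutator_subgroup G H H = derived G H"
  unfolding commutator_subgroup_def derived_def by (rule arg_cong[where f = "generate G"]) auto

(* The series starts at index 1; the value at index 0 is a dummy. *)
fun lower_central :: "('a, 'b) monoid_scheme \<Rightarrow> nat \<Rightarrow> 'a set" where
  "lower_central G 0 = carrier G"
| "lower_central G (Suc 0) = carrier G"
| "lower_central G (Suc (Suc j)) = commutator_subgroup G (lower_central G (Suc j)) (carrier G)"

(* Powerful and potent are defined here for odd p only; p = 2 has a different definition. *)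
definition powerful :: "nat \<Rightarrow> ('a, 'b) monoid_scheme \<Rightarrow> bool" where
  "powerful p G \<longleftrightarrow>
     odd p \<and> finite_p_group p G \<and> derived G (carrier G) \<subseteq> agemo p 1 G"

definition potent :: "nat \<Rightarrow> ('a, 'b) monoid_scheme \<Rightarrow> bool" where
  "potent p G \<longleftrightarrow>
     odd p \<and> finite_p_group p G \<and> lower_central G (p - 1) \<subseteq> agemo p 1 G"

definition M_group :: "nat \<Rightarrow> nat \<Rightarrow> ('a, 'b) monoid_scheme \<Rightarrow> bool" where
  "M_group p i G \<longleftrightarrow>
     finite_p_group p G \<and>
     (\<forall>H. subgroup H G \<and> card (rcosets\<^bsub>G\<^esub> H) = p ^ i \<longrightarrow> powerful p (G\<lparr>carrier := H\<rparr>))"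

end

theory Submission
  imports Defs
begin

text \<open>
  Write \<open>P\<close> for the subgroup generated by the \<open>p\<close>-th powers and call two elements of \<open>G\<close> commuting
  modulo \<open>N\<close> if their commutator lies in \<open>N\<close>. The case \<open>i = 0\<close> only says that \<open>G\<close> is itself
  powerful. For \<open>i > 0\<close> the point is that every normal subgroup \<open>N\<close> of index \<open>p ^ (i + 1)\<close> containing \<open>P\<close>
  is central modulo \<open>P\<close>: since \<open>N\<close> contains all \<open>p\<close>-th powers, adjoining any \<open>g\<close> outside \<open>N\<close> enlarges
  \<open>N\<close> by exactly the factor \<open>p\<close>, so \<open>N\<close> and \<open>g\<close> lie together in a subgroup \<open>H\<close> of index \<open>p ^ i\<close>, which
  is powerful; hence the commutators of \<open>N\<close> with \<open>g\<close> are in the subgroup generated by the \<open>p\<close>-th powers of \<open>H\<close>,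
  and so in \<open>P\<close> (\<open>M_group_centralizes_mod_agemo\<close>).

  A group of order \<open>p ^ (i + 1)\<close> has nilpotency class at most \<open>i\<close> when \<open>i > 0\<close>, so
  the term \<open>i + 1\<close> of the lower central series is contained in \<open>N\<close>
  (\<open>lower_central_subset_of_small_index\<close>). Commuting once more with \<open>G\<close> shows that the
  term \<open>i + 2\<close> is contained in \<open>P\<close>, and \<open>i + 2 \<le> p - 1\<close>. If the index
  of \<open>P\<close> is too small for such an \<open>N\<close> to exist, the bound on the class applies to \<open>P\<close> directly.

  Both the existence of \<open>N\<close> (\<open>exists_normal_of_index\<close>) and the bound on the class come from
  climbing up from a normal subgroup by central steps of order \<open>p\<close>
  (\<open>exists_central_extension\<close>), which rests on the nontriviality of the centre of a \<open>p\<close>-group.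
  Working modulo a normal subgroup inside \<open>G\<close>, instead of in the quotient, avoids transporting
  subgroups and lower central series along the projection.
\<close>

section \<open>Fixed points and central elements\<close>

text \<open>
  The orbits with more than one element have cardinality a positive power of \<open>p\<close>, so the number
  of fixed points is congruent to \<open>card E\<close> modulo \<open>p\<close>.
\<close>

lemma (in group_action) p_group_fixed_points:
  assumes p: "Factorial_Ring.prime p" and ord: "order G = p ^ n" and fin: "finite E"
    and dvd: "p dvd card E"
  shows "p dvd card {x \<in> E. \<forall>g \<in> carrier G. \<phi> g x = x}"
proof -
  interpret G: group G using group_hom group_hom.axioms(1) by blast
  let ?Fix = "{x \<in> E. \<forall>g \<in> carrier G. \<phi> g x = x}"
  let ?C = "{U \<in> orbits G E \<phi>. card U \<noteq> 1}"
  have one_orbit: "card (orbit G \<phi> x) = 1 \<longleftrightarrow> x \<in> ?Fix" if x: "x \<in> E" for x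
  proof
    assume "card (orbit G \<phi> x) = 1"
    then have "orbit G \<phi> x = {x}"
      using orbit_refl[OF x] by (metis card_1_singletonE singletonD)
    then show "x \<in> ?Fix" using x unfolding orbit_def by blast
  next
    assume "x \<in> ?Fix"
    then have "orbit G \<phi> x = {x}"
      using orbit_refl[OF x] unfolding orbit_def by auto
    then show "card (orbit G \<phi> x) = 1" by simp
  qed
  have un: "\<Union>?C = E - ?Fix"
  proof
    show "\<Union>?C \<subseteq> E - ?Fix"
    proof
      fix y assume "y \<in> \<Union>?C"
      then obtain U where U: "U \<in> orbits G E \<phi>" "card U \<noteq> 1" "y \<in> U" by auto
      then have y: "y \<in> E" using orbits_coverture by blast
      have "U = orbit G \<phi> y"
        using U y disjoint_union[of U "orbit G \<phi> y"] orbit_refl[OF y]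
        unfolding orbits_def by blast
      then show "y \<in> E - ?Fix" using U y one_orbit by blast
    qed
    show "E - ?Fix \<subseteq> \<Union>?C"
      using one_orbit orbit_refl unfolding orbits_def by blast
  qed
  have "p dvd card (\<Union>?C)"
  proof (rule dvd_partition)
    show "finite (\<Union>?C)" using un fin by simp
    show "\<forall>c\<in>?C. p dvd card c"
    proof
      fix c assume c: "c \<in> ?C"
      then obtain x where x: "x \<in> E" "c = orbit G \<phi> x" unfolding orbits_def by blast
      have "card c dvd p ^ n"
        using orbit_stabilizer_theorem[OF x(1)] ord x(2) by (metis dvd_triv_left)
      then obtain k where "card c = p ^ k" using divides_primepow_nat[OF p] by blast
      with c show "p dvd card c" by (cases k) auto
    qed
    show "\<forall>c1\<in>?C. \<forall>c2\<in>?C. c1 \<noteq> c2 \<longrightarrow> c1 \<inter> c2 = {}"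
      using disjoint_union by blast
  qed
  moreover have "card E = card (E - ?Fix) + card ?Fix"
    using card_Diff_subset[of ?Fix E] card_mono[OF fin, of ?Fix] fin by simp
  ultimately show ?thesis using dvd unfolding un by (simp only: dvd_add_right_iff)
qed

text \<open>
  The central elements are the fixed points of the conjugation action, so their number is a
  multiple of \<open>p\<close>; it is not zero because of the unit.
\<close>

lemma (in group) p_group_center_nontrivial:
  assumes p: "Factorial_Ring.prime p" and ord: "order G = p ^ n" and n: "n > 0"
  shows "\<exists>z \<in> carrier G. z \<noteq> \<one> \<and> (\<forall>g \<in> carrier G. g \<otimes> z = z \<otimes> g)"
proof -
  interpret conj: group_action G "carrier G" "\<lambda>g. \<lambda>h \<in> carrier G. g \<otimes> h \<otimes> inv g"
    by (rule action_by_conjugation)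
  let ?Z = "{z \<in> carrier G. \<forall>g \<in> carrier G. (\<lambda>h \<in> carrier G. g \<otimes> h \<otimes> inv g) z = z}"
  have "0 < order G" using ord p by (simp add: prime_gt_0_nat)
  then have fin: "finite (carrier G)" using order_gt_0_iff_finite by blast
  have "p dvd card ?Z"
    using conj.p_group_fixed_points[OF p ord fin] ord n by (simp add: order_def)
  moreover have one: "\<one> \<in> ?Z" by simp
  ultimately have "card ?Z \<noteq> 1" using p not_prime_unit by fastforce
  then obtain z where z: "z \<in> ?Z" "z \<noteq> \<one>"
    using one by (metis (no_types, lifting) is_singletonI' is_singleton_altdef empty_iff)
  have "g \<otimes> z = z \<otimes> g" if g: "g \<in> carrier G" for g
  proof -
    have "g \<otimes> z \<otimes> inv g = z" using z g by auto
    then show ?thesis using z g by (metis (no_types, lifting) inv_solve_right' m_closed mem_Collect_eq)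
  qed
  then show ?thesis using z by blast
qed

section \<open>Centralizers modulo a normal subgroup\<close>

text \<open>
  For normal \<open>N\<close> this is the preimage of the centralizer of the coset of \<open>g\<close> in the quotient by \<open>N\<close>.
\<close>

definition centralizer_mod :: "('a, 'b) monoid_scheme \<Rightarrow> 'a set \<Rightarrow> 'a \<Rightarrow> 'a set" where
  "centralizer_mod G N g =
     {h \<in> carrier G. h \<otimes>\<^bsub>G\<^esub> g \<otimes>\<^bsub>G\<^esub> inv\<^bsub>G\<^esub> h \<otimes>\<^bsub>G\<^esub> inv\<^bsub>G\<^esub> g \<in> N}"

lemma (in group) inv_commutator:
  assumes "a \<in> carrier G" "b \<in> carrier G"
  shows "inv (a \<otimes> b \<otimes> inv a \<otimes> inv b) = b \<otimes> a \<otimes> inv b \<otimes> inv a"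
  using assms by (simp add: inv_mult_group m_assoc)

lemma (in group) cancel_inv_left:
  "\<lbrakk>a \<in> carrier G; b \<in> carrier G\<rbrakk> \<Longrightarrow> inv a \<otimes> (a \<otimes> b) = b"
  "\<lbrakk>a \<in> carrier G; b \<in> carrier G\<rbrakk> \<Longrightarrow> a \<otimes> (inv a \<otimes> b) = b"
  by (simp_all flip: m_assoc)

lemma (in group) centralizer_mod_sym:
  assumes "subgroup N G" "g \<in> carrier G" "h \<in> centralizer_mod G N g"
  shows "g \<in> centralizer_mod G N h"
  using assms inv_commutator[of h g] subgroup.m_inv_closed[OF assms(1)]
  unfolding centralizer_mod_def by fastforce

lemma (in group) normal_subset_centralizer_mod:
  assumes N: "N \<lhd> G" and g: "g \<in> carrier G"
  shows "N \<subseteq> centralizer_mod G N g"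
proof
  interpret N: normal N G by (rule N)
  fix h assume h: "h \<in> N"
  then have hc: "h \<in> carrier G" by (rule N.mem_carrier)
  have "h \<otimes> (g \<otimes> inv h \<otimes> inv g) \<in> N"
    using h g N.inv_op_closed2 by blast
  then show "h \<in> centralizer_mod G N g"
    using hc g by (simp add: centralizer_mod_def m_assoc)
qed

lemma (in group) centralizer_mod_subgroup:
  assumes N: "N \<lhd> G" and g: "g \<in> carrier G"
  shows "subgroup (centralizer_mod G N g) G"
proof (rule subgroupI)
  interpret N: normal N G by (rule N)
  show "centralizer_mod G N g \<subseteq> carrier G" unfolding centralizer_mod_def by blast
  show "centralizer_mod G N g \<noteq> {}"
    using normal_subset_centralizer_mod[OF N g] N.one_closed by blast
  fix h assume h: "h \<in> centralizer_mod G N g"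
  then have hc: "h \<in> carrier G" and hN: "h \<otimes> g \<otimes> inv h \<otimes> inv g \<in> N"
    unfolding centralizer_mod_def by auto
  \<comment> \<open>\<open>[inv h, g]\<close> is the conjugate of the inverse of \<open>[h, g]\<close> by \<open>inv h\<close>.\<close>
  have "inv h \<otimes> (inv (h \<otimes> g \<otimes> inv h \<otimes> inv g)) \<otimes> h \<in> N"
    using hc hN N.inv_op_closed1 by blast
  moreover have "inv h \<otimes> (inv (h \<otimes> g \<otimes> inv h \<otimes> inv g)) \<otimes> h = inv h \<otimes> g \<otimes> inv (inv h) \<otimes> inv g"
    using hc g by (simp add: inv_mult_group m_assoc cancel_inv_left)
  ultimately show "inv h \<in> centralizer_mod G N g"
    using hc by (simp add: centralizer_mod_def)
  fix k assume k: "k \<in> centralizer_mod G N g"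
  then have kc: "k \<in> carrier G" and kN: "k \<otimes> g \<otimes> inv k \<otimes> inv g \<in> N"
    unfolding centralizer_mod_def by auto
  \<comment> \<open>\<open>[h k, g]\<close> is the product of the conjugate of \<open>[k, g]\<close> by \<open>h\<close> with \<open>[h, g]\<close>.\<close>
  have "(h \<otimes> (k \<otimes> g \<otimes> inv k \<otimes> inv g) \<otimes> inv h) \<otimes> (h \<otimes> g \<otimes> inv h \<otimes> inv g) \<in> N"
    using hc hN kN N.inv_op_closed2 by blast
  moreover have "(h \<otimes> (k \<otimes> g \<otimes> inv k \<otimes> inv g) \<otimes> inv h) \<otimes> (h \<otimes> g \<otimes> inv h \<otimes> inv g)
      = (h \<otimes> k) \<otimes> g \<otimes> inv (h \<otimes> k) \<otimes> inv g"
    using hc kc g by (simp add: inv_mult_group m_assoc cancel_inv_left)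
  ultimately show "h \<otimes> k \<in> centralizer_mod G N g"
    using hc kc by (simp add: centralizer_mod_def)
qed

text \<open>
  A representative of a nontrivial central element of the quotient by \<open>N\<close> serves as witness.
\<close>

lemma (in group) p_group_central_mod:
  assumes p: "Factorial_Ring.prime p" and ord: "order G = p ^ n"
    and N: "N \<lhd> G" and ne: "N \<noteq> carrier G"
  shows "\<exists>x \<in> carrier G - N. \<forall>g \<in> carrier G. x \<in> centralizer_mod G N g"
proof -
  interpret N: normal N G by (rule N)
  interpret Q: group "G Mod N" by (rule N.factorgroup_is_group)
  have "0 < order G" using ord p by (simp add: prime_gt_0_nat)
  then have fin: "finite (carrier G)" using order_gt_0_iff_finite by blast
  have lag: "order (G Mod N) * card N = p ^ n"
    using lagrange[OF N.subgroup_axioms] ord by (simp add: FactGroup_def order_def)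
  then obtain k where k: "order (G Mod N) = p ^ k"
    using divides_primepow_nat[OF p] by (metis dvd_triv_left)
  have "k \<noteq> 0"
  proof
    assume "k = 0"
    then have "card N = card (carrier G)" using lag k ord by (simp add: order_def)
    then show False using ne fin N.subset card_subset_eq by blast
  qed
  then obtain z where z: "z \<in> carrier (G Mod N)" "z \<noteq> \<one>\<^bsub>G Mod N\<^esub>"
    and comm: "\<And>g. g \<in> carrier (G Mod N) \<Longrightarrow> g \<otimes>\<^bsub>G Mod N\<^esub> z = z \<otimes>\<^bsub>G Mod N\<^esub> g"
    using Q.p_group_center_nontrivial[OF p k] by blast
  obtain x where x: "x \<in> carrier G" "z = N #> x"
    using z(1) by (auto simp: carrier_FactGroup)
  have "x \<notin> N"
    using z(2) x N.rcos_const by (auto simp: is_group)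
  moreover have "x \<in> centralizer_mod G N g" if g: "g \<in> carrier G" for g
  proof -
    have "N #> (g \<otimes> x) = N #> (x \<otimes> g)"
      using comm[of "N #> g"] g x by (simp add: carrier_FactGroup N.rcos_sum)
    then have "x \<otimes> g \<in> N #> (g \<otimes> x)"
      using rcos_self[OF _ N.subgroup_axioms, of "x \<otimes> g"] g x by simp
    then obtain a where a: "a \<in> N" "x \<otimes> g = a \<otimes> (g \<otimes> x)"
      unfolding r_coset_def by blast
    then have "x \<otimes> g \<otimes> inv x \<otimes> inv g = a"
      using g x N.mem_carrier[OF a(1)] by (simp add: m_assoc)
    then show ?thesis using a(1) x by (simp add: centralizer_mod_def)
  qed
  ultimately show ?thesis using x(1) by blast
qed

section \<open>Adjoining one element to a normal subgroup\<close>

text \<open>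
  As \<open>x [^] p\<close> is in \<open>N\<close>, the cosets of \<open>N\<close> by the \<open>p\<close> powers of \<open>x\<close> with exponent below \<open>p\<close> cover
  the subgroup generated by \<open>N\<close> and \<open>x\<close>, whose order is therefore at most \<open>p * card N\<close>. That order is
  a power of \<open>p\<close> larger than \<open>card N\<close>, which gives the other inequality.
\<close>

lemma (in group) card_adjoin:
  assumes p: "Factorial_Ring.prime p" and ord: "order G = p ^ n"
    and N: "N \<lhd> G" and x: "x \<in> carrier G" "x \<notin> N" and xp: "x [^] p \<in> N"
  shows "card (generate G (insert x N)) = p * card N"
proof -
  interpret N: normal N G by (rule N)
  let ?H = "generate G (insert x N)"
  have p0: "0 < p" using p by (simp add: prime_gt_0_nat)
  then have "0 < order G" using ord by simp
  then have fin: "finite (carrier G)" using order_gt_0_iff_finite by blast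
  have H: "subgroup ?H G" using x N.subset by (intro generate_is_subgroup) auto
  have finN: "finite N" and finH: "finite ?H"
    using fin N.subset subgroup.subset[OF H] finite_subset by blast+
  have NH: "insert x N \<subseteq> ?H" using generate.incl by (metis subsetI)
  let ?A = "generate G {x}"
  have A: "subgroup ?A G" using x by (intro generate_is_subgroup) auto
  have NA: "subgroup (N <#> ?A) G" by (rule mult_norm_subgroup[OF N A])
  have "x \<in> N <#> ?A"
    unfolding set_mult_def
    using N.one_closed generate.incl[of x "{x}" G] l_one[OF x(1), symmetric] by blast
  moreover have "N \<subseteq> N <#> ?A"
  proof
    fix a assume "a \<in> N"
    then show "a \<in> N <#> ?A"
      unfolding set_mult_def
      using generate.one[of G "{x}"] r_one[OF N.mem_carrier, symmetric] by blast
  qed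
  ultimately have "?H \<subseteq> N <#> ?A"
    by (intro generate_subgroup_incl[OF _ NA]) auto
  also have "\<dots> \<subseteq> (\<Union>r \<in> {..<p}. N #> (x [^] r))"
  proof
    fix y assume "y \<in> N <#> ?A"
    then obtain a k where a: "a \<in> N" and y: "y = a \<otimes> x [^] (k::int)"
      unfolding set_mult_def generate_pow[OF x(1)] by blast
    define r where "r = nat (k mod int p)"
    have r: "int r = k mod int p" "r < p" using p0 by (auto simp: r_def nat_less_iff)
    have "x [^] k = x [^] (int p * (k div int p) + int r)" using r by simp
    also have "\<dots> = (x [^] int p) [^] (k div int p) \<otimes> x [^] int r"
      using x by (simp add: int_pow_mult int_pow_pow)
    finally have "x [^] k = (x [^] p) [^] (k div int p) \<otimes> x [^] r"
      by (simp add: int_pow_int)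
    moreover have b: "(x [^] p) [^] (k div int p) \<in> N"
      using subgroup_int_pow_closed[OF N.subgroup_axioms xp] .
    ultimately have "y = (a \<otimes> (x [^] p) [^] (k div int p)) \<otimes> x [^] r"
      using y a x N.mem_carrier by (simp add: m_assoc)
    then show "y \<in> (\<Union>r \<in> {..<p}. N #> (x [^] r))"
      using r(2) a b unfolding r_coset_def by blast
  qed
  finally have sub: "?H \<subseteq> (\<Union>r \<in> {..<p}. N #> (x [^] r))" .
  have cos: "card (N #> (x [^] r)) = card N" for r :: nat
    using card_rcosets_equal[of "N #> (x [^] r)" N] rcosetsI[OF N.subset] x N.subset by simp
  have "card ?H \<le> card (\<Union>r \<in> {..<p}. N #> (x [^] r))"
    using sub fin N.subset x by (intro card_mono) (auto intro!: finite_subset[OF r_coset_subset_G])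
  also have "\<dots> \<le> (\<Sum>r<p. card (N #> (x [^] r)))" by (rule card_UN_le) simp
  also have "\<dots> = p * card N" by (simp add: cos)
  finally have upper: "card ?H \<le> p * card N" .
  have "card N dvd p ^ n" "card ?H dvd p ^ n"
    using lagrange[OF N.subgroup_axioms] lagrange[OF H] ord by (metis dvd_triv_right)+
  then obtain a b where ab: "card N = p ^ a" "card ?H = p ^ b"
    using divides_primepow_nat[OF p] by blast
  have "N \<subset> ?H" using NH x by blast
  then have "p ^ a < p ^ b" using ab finH psubset_card_mono by metis
  then have "a < b" using power_less_imp_less_exp[OF prime_gt_1_nat[OF p]] by blast
  then have "p ^ Suc a \<le> p ^ b" using p0 by (intro power_increasing) auto
  then show ?thesis using upper ab by simp
qed

text \<open>
  Conjugating an element that commutes with \<open>G\<close> modulo \<open>N\<close> changes it only by a factor in \<open>N\<close>.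
\<close>

lemma (in group) normal_adjoin_central:
  assumes N: "N \<lhd> G" and x: "x \<in> carrier G" "\<And>g. g \<in> carrier G \<Longrightarrow> x \<in> centralizer_mod G N g"
  shows "generate G (insert x N) \<lhd> G"
    and "\<And>g. g \<in> carrier G \<Longrightarrow> generate G (insert x N) \<subseteq> centralizer_mod G N g"
proof -
  interpret N: normal N G by (rule N)
  let ?H = "generate G (insert x N)"
  have H: "subgroup ?H G" using x N.subset by (intro generate_is_subgroup) auto
  have NH: "N \<subseteq> ?H" using generate.incl by (metis insertCI subsetI)
  show cent: "?H \<subseteq> centralizer_mod G N g" if g: "g \<in> carrier G" for g
    using x(2)[OF g] normal_subset_centralizer_mod[OF N g]
    by (intro generate_subgroup_incl[OF _ centralizer_mod_subgroup[OF N g]]) auto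
  show "?H \<lhd> G"
  proof (rule normal_invI[OF H])
    fix g h assume g: "g \<in> carrier G" and h: "h \<in> ?H"
    have hc: "h \<in> carrier G" using h subgroup.mem_carrier[OF H] by blast
    have "g \<in> centralizer_mod G N h"
      using centralizer_mod_sym[OF N.subgroup_axioms g] cent[OF g] h by blast
    then have "g \<otimes> h \<otimes> inv g \<otimes> inv h \<in> ?H" using NH unfolding centralizer_mod_def by blast
    then have "g \<otimes> h \<otimes> inv g \<otimes> inv h \<otimes> h \<in> ?H" using h subgroup.m_closed[OF H] by blast
    then show "g \<otimes> h \<otimes> inv g \<in> ?H" using g hc by (simp add: m_assoc)
  qed
qed

text \<open>
  One step of a central series upwards from \<open>N\<close>. The assumption on \<open>p\<close>-th powers guarantees that
  the step has order exactly \<open>p\<close> whichever central element modulo \<open>N\<close> is adjoined.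
\<close>

lemma (in group) exists_central_extension:
  assumes p: "Factorial_Ring.prime p" and ord: "order G = p ^ n"
    and N: "N \<lhd> G" and ne: "N \<noteq> carrier G" and pow: "\<And>g. g \<in> carrier G \<Longrightarrow> g [^] p \<in> N"
  obtains M where "M \<lhd> G" "N \<subseteq> M" "card M = p * card N"
    "\<And>g. g \<in> carrier G \<Longrightarrow> M \<subseteq> centralizer_mod G N g"
proof -
  obtain x where x: "x \<in> carrier G" "x \<notin> N" "\<And>g. g \<in> carrier G \<Longrightarrow> x \<in> centralizer_mod G N g"
    using p_group_central_mod[OF p ord N ne] by blast
  show ?thesis
  proof (rule that[of "generate G (insert x N)"])
    show "N \<subseteq> generate G (insert x N)" using generate.incl by (metis insertCI subsetI)
  qed (use normal_adjoin_central[OF N x(1,3)] card_adjoin[OF p ord N x(1,2) pow[OF x(1)]] in auto)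
qed

section \<open>The lower central series\<close>

lemma (in group) lower_central_subset_carrier: "lower_central G j \<subseteq> carrier G"
proof (induction j rule: less_induct)
  case (less j)
  consider "j = 0" | "j = 1" | k where "j = Suc (Suc k)"
    by (metis One_nat_def not0_implies_Suc)
  then show ?case
  proof cases
    case 3
    then have "lower_central G (Suc k) \<subseteq> carrier G" using less by simp
    then show ?thesis
      unfolding 3 lower_central.simps commutator_subgroup_def
      by (intro generate_incl) blast
  qed auto
qed

lemma (in group) lower_central_step:
  assumes N: "N \<lhd> G" and M: "lower_central G (Suc j) \<subseteq> M"
    and cent: "\<And>g. g \<in> carrier G \<Longrightarrow> M \<subseteq> centralizer_mod G N g"
  shows "lower_central G (Suc (Suc j)) \<subseteq> N"
proof -
  interpret N: normal N G by (rule N)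
  show ?thesis
    unfolding lower_central.simps commutator_subgroup_def
    using M cent unfolding centralizer_mod_def
    by (intro generate_subgroup_incl[OF _ N.subgroup_axioms]) blast
qed

text \<open>
  A normal subgroup absorbs commutators with \<open>G\<close>, so it contains the whole series from the first
  term it contains. Index \<open>0\<close> is excluded because it is a dummy value of the series.
\<close>

lemma (in group) lower_central_subset_mono:
  assumes N: "N \<lhd> G" and j: "0 < j" "j \<le> k" and sub: "lower_central G j \<subseteq> N"
  shows "lower_central G k \<subseteq> N"
  using j(2)
proof (induction k rule: dec_induct)
  case (step k)
  then show ?case
    using lower_central_step[OF N, of "k - 1"] normal_subset_centralizer_mod[OF N] j(1) by auto
qed (rule sub)

text \<open>
  This is the commutativity of groups of order at most \<open>p ^ 2\<close>, read modulo \<open>N\<close>. With \<open>M\<close> of order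
  \<open>p * card N\<close> central modulo \<open>N\<close>, an element \<open>g\<close> outside \<open>M\<close> generates \<open>G\<close> together with \<open>M\<close>, and it
  commutes modulo \<open>N\<close> with both \<open>M\<close> and itself.
\<close>

lemma (in group) p_group_abelian_mod:
  assumes p: "Factorial_Ring.prime p" and ord: "order G = p ^ n"
    and N: "N \<lhd> G" and pow: "\<And>g. g \<in> carrier G \<Longrightarrow> g [^] p \<in> N"
    and idx: "order G \<le> p ^ 2 * card N" and g: "g \<in> carrier G"
  shows "carrier G \<subseteq> centralizer_mod G N g"
proof (cases "N = carrier G")
  case True
  then show ?thesis using normal_subset_centralizer_mod[OF N g] by simp
next
  case False
  interpret N: normal N G by (rule N)
  have "0 < order G" using ord p by (simp add: prime_gt_0_nat)
  then have fin: "finite (carrier G)" using order_gt_0_iff_finite by blast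
  obtain M where M: "M \<lhd> G" "N \<subseteq> M" "card M = p * card N"
    "\<And>g. g \<in> carrier G \<Longrightarrow> M \<subseteq> centralizer_mod G N g"
    using exists_central_extension[OF p ord N False pow] by blast
  interpret M: normal M G by (rule M(1))
  have C: "subgroup (centralizer_mod G N g) G" by (rule centralizer_mod_subgroup[OF N g])
  show ?thesis
  proof (cases "g \<in> M")
    case True
    then show ?thesis using M(4) centralizer_mod_sym[OF N.subgroup_axioms] g by blast
  next
    case False
    have "g \<in> centralizer_mod G N g"
      using g N.one_closed by (simp add: centralizer_mod_def m_assoc cancel_inv_left)
    then have sub: "generate G (insert g M) \<subseteq> centralizer_mod G N g"
      using M(4)[OF g] by (intro generate_subgroup_incl[OF _ C]) auto
    have "card (generate G (insert g M)) = p * card M"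
      using card_adjoin[OF p ord M(1) g False] pow[OF g] M(2) by blast
    then have "card (carrier G) \<le> card (generate G (insert g M))"
      using idx M(3) by (simp add: order_def power2_eq_square)
    moreover have "generate G (insert g M) \<subseteq> carrier G"
      using g M.subset by (intro generate_incl) auto
    ultimately have "generate G (insert g M) = carrier G"
      using fin card_seteq by blast
    then show ?thesis using sub by simp
  qed
qed

text \<open>
  The bound on the nilpotency class of a group of order at most \<open>p ^ (k + 1)\<close>, read modulo \<open>N\<close>. The induction
  passes from \<open>N\<close> to a central extension \<open>M\<close> of smaller index. It starts at index \<open>p ^ 2\<close>, where
  commutativity saves one step; without this the last term would be one too far for the
  hypothesis \<open>i \<le> p - 3\<close> of the main theorem.
\<close>

lemma (in group) lower_central_subset_of_small_index:
  assumes p: "Factorial_Ring.prime p" and ord: "order G = p ^ n"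
    and k: "1 \<le> k"
    and N: "N \<lhd> G" and pow: "\<And>g. g \<in> carrier G \<Longrightarrow> g [^] p \<in> N"
    and idx: "order G \<le> p ^ Suc k * card N"
  shows "lower_central G (Suc k) \<subseteq> N"
  using k N pow idx
proof (induction k arbitrary: N rule: dec_induct)
  case base
  then show ?case
    using lower_central_step[OF base(1), of 0 "carrier G"]
      p_group_abelian_mod[OF p ord base(1,2)]
    by (simp add: power2_eq_square)
next
  case (step k)
  show ?case
  proof (cases "N = carrier G")
    case True
    then show ?thesis using lower_central_subset_carrier by blast
  next
    case False
    then obtain M where M: "M \<lhd> G" "N \<subseteq> M" "card M = p * card N"
      "\<And>g. g \<in> carrier G \<Longrightarrow> M \<subseteq> centralizer_mod G N g"
      using exists_central_extension[OF p ord step.prems(1) _ step.prems(2)] by blast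
    have "lower_central G (Suc k) \<subseteq> M"
      using step.IH[OF M(1)] step.prems M by (auto simp: ac_simps)
    then show ?thesis by (rule lower_central_step[OF step.prems(1) _ M(4)])
  qed
qed

section \<open>Intermediate normal subgroups\<close>

lemma (in group) exists_normal_of_index:
  assumes p: "Factorial_Ring.prime p" and ord: "order G = p ^ n"
    and P: "P \<lhd> G" and pow: "\<And>g. g \<in> carrier G \<Longrightarrow> g [^] p \<in> P"
    and idx: "p ^ k * card P \<le> order G"
  obtains N where "N \<lhd> G" "P \<subseteq> N" "order G = p ^ k * card N"
proof -
  interpret P: normal P G by (rule P)
  have p1: "1 < p" using p by (rule prime_gt_1_nat)
  obtain r where r: "card P = p ^ r"
    using lagrange[OF P.subgroup_axioms] ord divides_primepow_nat[OF p] by (metis dvd_triv_right)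
  have "p ^ (k + r) \<le> p ^ n" using idx ord r by (simp add: power_add)
  then have krn: "k + r \<le> n" using p1 power_le_imp_le_exp by blast
  have "j \<le> n \<longrightarrow> (\<exists>N. N \<lhd> G \<and> P \<subseteq> N \<and> card N = p ^ j)" if "r \<le> j" for j
    using that
  proof (induction j rule: dec_induct)
    case base
    then show ?case using P r by blast
  next
    case (step j)
    show ?case
    proof
      assume "Suc j \<le> n"
      then obtain N where N: "N \<lhd> G" "P \<subseteq> N" "card N = p ^ j" using step.IH by auto
      have "N \<noteq> carrier G"
        using N(3) ord p1 \<open>Suc j \<le> n\<close> power_inject_exp[OF p1] by (auto simp: order_def)
      then show "\<exists>N. N \<lhd> G \<and> P \<subseteq> N \<and> card N = p ^ Suc j"
        using exists_central_extension[OF p ord N(1)] pow N by (metis power_Suc subset_iff)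
    qed
  qed
  moreover have "r \<le> n - k" using krn by simp
  ultimately obtain N where "N \<lhd> G" "P \<subseteq> N" "card N = p ^ (n - k)"
    by (meson diff_le_self)
  then show ?thesis using that ord krn by (simp flip: power_add)
qed

section \<open>Powerful subgroups and potency\<close>

lemma (in group) agemo_normal: "agemo p k G \<lhd> G"
  unfolding agemo_def
proof (rule normal_generateI)
  show "{g [^] p ^ k |g. g \<in> carrier G} \<subseteq> carrier G" by auto
  fix h g assume "h \<in> {g [^] p ^ k |g. g \<in> carrier G}" and g: "g \<in> carrier G"
  then obtain x where x: "x \<in> carrier G" "h = x [^] (p ^ k)" by blast
  have "(g \<otimes> x \<otimes> inv g) [^] m = g \<otimes> x [^] m \<otimes> inv g" for m :: nat
  proof (induction m)
    case (Suc m)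
    then show ?case using g x by (simp add: m_assoc cancel_inv_left)
  qed (use g in simp)
  then have "g \<otimes> h \<otimes> inv g = (g \<otimes> x \<otimes> inv g) [^] (p ^ k)" using x(2) by simp
  moreover have "g \<otimes> x \<otimes> inv g \<in> carrier G" using g x(1) by simp
  ultimately show "g \<otimes> h \<otimes> inv g \<in> {g [^] p ^ k |g. g \<in> carrier G}" by blast
qed

lemma (in group) agemo_subgroup_subset:
  assumes H: "subgroup H G"
  shows "agemo p k (G\<lparr>carrier := H\<rparr>) \<subseteq> agemo p k G"
proof -
  have pow: "h [^]\<^bsub>G\<lparr>carrier := H\<rparr>\<^esub> m = h [^] m" for h and m :: nat
    by (simp add: nat_pow_def)
  let ?S = "{g [^]\<^bsub>G\<lparr>carrier := H\<rparr>\<^esub> p ^ k |g. g \<in> carrier (G\<lparr>carrier := H\<rparr>)}"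
  interpret H: group "G\<lparr>carrier := H\<rparr>" by (rule subgroup_imp_group[OF H])
  have "?S \<subseteq> H" using H.nat_pow_closed by fastforce
  then have "generate (G\<lparr>carrier := H\<rparr>) ?S = generate G ?S"
    by (rule generate_consistent[OF _ H])
  also have "\<dots> \<subseteq> generate G {g [^] p ^ k |g. g \<in> carrier G}"
    using subgroup.mem_carrier[OF H] by (intro mono_generate) (auto simp: pow)
  finally show ?thesis by (simp add: agemo_def)
qed

lemma (in group) M_group_commutator_in_agemo:
  assumes M: "M_group p i G" and H: "subgroup H G" and idx: "order G = p ^ i * card H"
    and ab: "a \<in> H" "b \<in> H"
  shows "a \<in> centralizer_mod G (agemo p 1 G) b"
proof -
  have "0 < order G"
    using M by (auto simp: M_group_def finite_p_group_def prime_gt_0_nat)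
  then have "card (rcosets H) = p ^ i"
    using lagrange[OF H] idx by auto
  then have "derived (G\<lparr>carrier := H\<rparr>) H \<subseteq> agemo p 1 (G\<lparr>carrier := H\<rparr>)"
    using M H by (auto simp: M_group_def powerful_def)
  then have "derived G H \<subseteq> agemo p 1 G"
    using agemo_subgroup_subset[OF H] derived_consistent[OF subset_refl H] by blast
  moreover have "a \<otimes> b \<otimes> inv a \<otimes> inv b \<in> derived G H"
    using ab unfolding derived_def by (intro generate.incl) blast
  ultimately show ?thesis
    using subgroup.mem_carrier[OF H] ab by (auto simp: centralizer_mod_def)
qed

text \<open>
  The key step: \<open>N\<close> and \<open>g\<close> lie in a common subgroup of index \<open>p ^ i\<close>. If \<open>g\<close> is in \<open>N\<close> already, any
  element outside \<open>N\<close> may be adjoined instead.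
\<close>

lemma (in group) M_group_centralizes_mod_agemo:
  assumes M: "M_group p i G" and N: "N \<lhd> G" and PN: "agemo p 1 G \<subseteq> N"
    and idx: "order G = p ^ Suc i * card N" and g: "g \<in> carrier G"
  shows "N \<subseteq> centralizer_mod G (agemo p 1 G) g"
proof
  fix a assume a: "a \<in> N"
  interpret N: normal N G by (rule N)
  obtain n where p: "Factorial_Ring.prime p" and ord: "order G = p ^ n"
    using M by (auto simp: M_group_def finite_p_group_def)
  have p1: "1 < p" using p by (rule prime_gt_1_nat)
  have "card N \<noteq> 0" using idx ord p1 by (metis mult_0_right not_one_less_zero power_not_zero)
  have "N \<noteq> carrier G"
    using idx p1 \<open>card N \<noteq> 0\<close> by (auto simp: order_def)
  then obtain y where y: "y \<in> carrier G" "y \<notin> N" "g \<in> N \<or> y = g"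
    using g N.subset by blast
  let ?H = "generate G (insert y N)"
  have H: "subgroup ?H G" using y N.subset by (intro generate_is_subgroup) auto
  have NH: "insert y N \<subseteq> ?H" using generate.incl by (metis subsetI)
  have "y [^] p \<in> agemo p 1 G"
    using y unfolding agemo_def by (intro generate.incl) auto
  then have "card ?H = p * card N"
    using card_adjoin[OF p ord N y(1,2)] PN by blast
  then have "order G = p ^ i * card ?H" using idx by simp
  then show "a \<in> centralizer_mod G (agemo p 1 G) g"
    using M_group_commutator_in_agemo[OF M H] NH y(3) a by blast
qed

theorem theoremA:
  fixes G :: "('a, 'b) monoid_scheme" and p i :: nat
  assumes "Factorial_Ring.prime p" and "odd p"
    and "finite_p_group p G"
    and "i \<le> p - 3"
    and "M_group p i G"
  shows "potent p G"
proof -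
  interpret group G using assms(3) by (simp add: finite_p_group_def)
  note p = assms(1)
  obtain n where ord: "order G = p ^ n" using assms(3) by (auto simp: finite_p_group_def)
  have "p \<noteq> 2" using assms(2) by auto
  then have p3: "3 \<le> p" using prime_ge_2_nat[OF p] by simp
  define P where "P = agemo p 1 G"
  have P: "P \<lhd> G" unfolding P_def by (rule agemo_normal)
  have pow: "g [^]\<^bsub>G\<^esub> p \<in> P" if "g \<in> carrier G" for g
    using that unfolding P_def agemo_def by (intro generate.incl) auto
  have sub: "lower_central G (i + 2) \<subseteq> P"
  proof (cases "i = 0")
    case True
    have "carrier G \<subseteq> centralizer_mod G P g" if "g \<in> carrier G" for g
      using M_group_commutator_in_agemo[OF assms(5) subgroup_self] True that
      by (auto simp: P_def order_def)
    then show ?thesis using lower_central_step[OF P, of 0 "carrier G"] True by (simp add: numeral_2_eq_2)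
  next
    case False
    show ?thesis
    proof (cases "order G \<le> p ^ Suc i * card P")
      case True
      have "lower_central G (Suc i) \<subseteq> P"
        using False by (intro lower_central_subset_of_small_index[OF p ord _ P pow True]) auto
      then show ?thesis by (rule lower_central_subset_mono[OF P, rotated 2]) auto
    next
      case big: False
      obtain N where N: "N \<lhd> G" "P \<subseteq> N" "order G = p ^ Suc i * card N"
        using exists_normal_of_index[OF p ord P pow, of "Suc i"] big by auto
      have "lower_central G (Suc i) \<subseteq> N"
        using N False pow by (intro lower_central_subset_of_small_index[OF p ord _ N(1)]) auto
      then have "lower_central G (Suc (Suc i)) \<subseteq> P"
        using M_group_centralizes_mod_agemo[OF assms(5) N(1) _ N(3)] N(2)
        by (intro lower_central_step[OF P]) (auto simp: P_def)
      then show ?thesis by simp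
    qed
  qed
  have le: "i + 2 \<le> p - 1" using assms(4) p3 by simp
  have "lower_central G (p - 1) \<subseteq> P"
    by (rule lower_central_subset_mono[OF P _ le sub]) simp
  then show ?thesis using assms(2,3) unfolding potent_def P_def by blast
qed

end
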